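(* There exists a 1-total-2-perfect lacunar semi-total coloring (sTC) $\mu$ of the Foster graph $Fos$.
   Context: The Foster graph $Fos$ is the 90-vertex cubic distance-transitive graph with intersection array $\{3,2,2,2,2,1,1,1;1,1,1,1,2,2,2,3\}$; it is Hamiltonian with LCF notation $[17,-9,37,-37,9,-17]^{15}$, i.e. its vertices may be taken as $0,1,\ldots,89$ (mod 90), with edges joining $i$ to $i+1$ for all $i$, together with an edge joining $i$ to $i+a_{i \bmod 6}$, where $(a_0,\ldots,a_5)=(17,-9,37,-37,9,-17)$. For a cubic graph $G$ the color set is $\chi(3)=\{0,1,2,3\}$. A semi-total coloring (sTC) of $G$ is a function $\mu:V(G)\cup E(G)\to\chi(3)$ such that every two adjacent edges have distinct colors and every vertex has a color distinct from the colors of its incident edges (adjacent vertices may have equal colors). It is lacunar if some color $c\in\chi(3)$ is assigned to no vertex. A $\beta$-edge of $\mu$ is an edge whose endvertices have the same color. The $\mu$-class of a color is the set of vertices and edges with that color. A total perfect code of $G=(V,E)$ is a set $S\subseteq V$ such that $|N(v)\cap S|=1$ for all $v\in V$, where $N(v)$ is the open neighborhood of $v$. A lacunar sTC $\mu$ of a cubic graph $G$ is said to be 1-total-2-perfect if exactly one $\mu$-class has as its vertex set a total perfect code formed by the endvertices of $\beta$-edges. *)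

theory Defs
  imports Main "HOL-Library.FuncSet"
begin

definition simple_graph :: "'a set \<Rightarrow> 'a set set \<Rightarrow> bool" where
  "simple_graph V E \<longleftrightarrow> finite V \<and> (\<forall>e\<in>E. e \<subseteq> V \<and> card e = 2)"

definition open_nbhd :: "'a set set \<Rightarrow> 'a \<Rightarrow> 'a set" where
  "open_nbhd E v = {w. {v, w} \<in> E}"

definition cubic_graph :: "'a set \<Rightarrow> 'a set set \<Rightarrow> bool" where
  "cubic_graph V E \<longleftrightarrow> simple_graph V E \<and> (\<forall>v\<in>V. card (open_nbhd E v) = 3)"

definition colors :: "nat set" where
  "colors = {0, 1, 2, 3}"

(* A coloring of the disjoint union V + E: vertices are tagged Inl, edges Inr. *)
type_synonym 'a coloring = "'a + 'a set \<Rightarrow> nat"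

definition semi_total_coloring :: "'a set \<Rightarrow> 'a set set \<Rightarrow> 'a coloring \<Rightarrow> bool" where
  "semi_total_coloring V E \<mu> \<longleftrightarrow>
     cubic_graph V E \<and>
     \<mu> \<in> V <+> E \<rightarrow> colors \<and>
     (\<forall>e\<in>E. \<forall>f\<in>E. e \<noteq> f \<and> e \<inter> f \<noteq> {} \<longrightarrow> \<mu> (Inr e) \<noteq> \<mu> (Inr f)) \<and>
     (\<forall>v\<in>V. \<forall>e\<in>E. v \<in> e \<longrightarrow> \<mu> (Inl v) \<noteq> \<mu> (Inr e))"

definition lacunar_stc :: "'a set \<Rightarrow> 'a set set \<Rightarrow> 'a coloring \<Rightarrow> bool" where
  "lacunar_stc V E \<mu> \<longleftrightarrow>
     semi_total_coloring V E \<mu> \<and> (\<exists>c\<in>colors. \<forall>v\<in>V. \<mu> (Inl v) \<noteq> c)"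

definition beta_edges :: "'a set set \<Rightarrow> 'a coloring \<Rightarrow> 'a set set" where
  "beta_edges E \<mu> = {e \<in> E. \<forall>u\<in>e. \<forall>v\<in>e. \<mu> (Inl u) = \<mu> (Inl v)}"

definition color_class :: "'a set \<Rightarrow> 'a set set \<Rightarrow> 'a coloring \<Rightarrow> nat \<Rightarrow> ('a + 'a set) set" where
  "color_class V E \<mu> c = {x \<in> V <+> E. \<mu> x = c}"

definition vertex_part :: "('a + 'a set) set \<Rightarrow> 'a set" where
  "vertex_part C = {v. Inl v \<in> C}"

definition total_perfect_code :: "'a set \<Rightarrow> 'a set set \<Rightarrow> 'a set \<Rightarrow> bool" where
  "total_perfect_code V E S \<longleftrightarrow>
     S \<subseteq> V \<and> (\<forall>v\<in>V. card (open_nbhd E v \<inter> S) = 1)"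

(* "Formed by the endvertices of beta-edges" is read as a set equality: the code consists of
   the endvertices of all beta-edges of the coloring, whatever their common end color. *)
definition one_total_two_perfect :: "'a set \<Rightarrow> 'a set set \<Rightarrow> 'a coloring \<Rightarrow> bool" where
  "one_total_two_perfect V E \<mu> \<longleftrightarrow>
     lacunar_stc V E \<mu> \<and>
     (\<exists>!c. c \<in> colors \<and>
        total_perfect_code V E (vertex_part (color_class V E \<mu> c)) \<and>
        vertex_part (color_class V E \<mu> c) = \<Union> (beta_edges E \<mu>))"

definition foster_verts :: "int set" where
  "foster_verts = {0..<90}"

definition foster_jump :: "int \<Rightarrow> int" where
  "foster_jump i = [17, -9, 37, -37, 9, -17] ! nat (i mod 6)"

(* LCF notation [17,-9,37,-37,9,-17]^15 *)
definition foster_edges :: "int set set" where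
  "foster_edges =
     {{i, (i + 1) mod 90} | i. i \<in> foster_verts} \<union>
     {{i, (i + foster_jump i) mod 90} | i. i \<in> foster_verts}"

end

theory Submission
  imports Defs
begin

text \<open>
  Read the LCF presentation modulo 3. Since 3 divides 90, the residues \<open>0, 1, 2\<close> repeat around
  the Hamiltonian cycle, so coloring each vertex by its residue makes the cycle edge between
  \<open>r\<close> and \<open>r + 1\<close> miss exactly the residue \<open>r + 2\<close>, which becomes its color. At every vertex the
  two cycle edges and the vertex itself then use the colors 0, 1, 2 once each. The chords form a
  perfect matching, so all of them may take the color 3. This is a semi-total coloring
  (\<open>residue_coloring_lacunar\<close>), and it is lacunar because no vertex has color 3.

  The jumps \<open>17, -9, 37, -37, 9, -17\<close> are \<open>2, 0, 1, 2, 0, 1\<close> modulo 3. Hence a chord fixes the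
  residue 1 and exchanges the residues 0 and 2 (\<open>chord_mod_3\<close>). So the edges with equally colored
  ends are precisely the chords between vertices of residue 1 (\<open>Union_beta_edges\<close>), and each vertex
  has exactly one neighbor of residue 1: its successor, its chord partner or its predecessor,
  according to whether its own residue is 0, 1 or 2 (\<open>residue_one_total_perfect_code\<close>).
\<close>

section \<open>The cubic graph in LCF form\<close>

definition succ90 :: "int \<Rightarrow> int" where
  "succ90 i = (i + 1) mod 90"

definition pred90 :: "int \<Rightarrow> int" where
  "pred90 i = (i - 1) mod 90"

definition chord :: "int \<Rightarrow> int" where
  "chord i = (i + foster_jump i) mod 90"

lemma jump_cases:
  obtains "i mod 6 = 0" "foster_jump i = 17" | "i mod 6 = 1" "foster_jump i = -9"
  | "i mod 6 = 2" "foster_jump i = 37" | "i mod 6 = 3" "foster_jump i = -37"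
  | "i mod 6 = 4" "foster_jump i = 9" | "i mod 6 = 5" "foster_jump i = -17"
proof -
  have "i mod 6 = 0 \<or> i mod 6 = 1 \<or> i mod 6 = 2 \<or> i mod 6 = 3 \<or> i mod 6 = 4 \<or> i mod 6 = 5"
    by presburger
  then show thesis
    using that by (elim disjE) (simp_all add: foster_jump_def)
qed

lemma in_foster_verts [simp]:
  "succ90 i \<in> foster_verts" "pred90 i \<in> foster_verts" "chord i \<in> foster_verts"
  by (simp_all add: succ90_def pred90_def chord_def foster_verts_def)

lemma mod_90_vertex: "v \<in> foster_verts \<Longrightarrow> v mod 90 = v"
  by (simp add: foster_verts_def)

lemma pred90_succ90 [simp]: "v \<in> foster_verts \<Longrightarrow> pred90 (succ90 v) = v"
  by (simp add: succ90_def pred90_def mod_diff_left_eq mod_90_vertex)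

lemma succ90_pred90 [simp]: "v \<in> foster_verts \<Longrightarrow> succ90 (pred90 v) = v"
  by (simp add: succ90_def pred90_def mod_add_left_eq mod_90_vertex)

text \<open>
  The LCF pattern is consistent: along a jump, position \<open>r\<close> of the pattern is sent to position
  \<open>5 - r\<close>, where the entry is the negative.
\<close>
lemma chord_chord [simp]:
  assumes "v \<in> foster_verts"
  shows "chord (chord v) = v"
proof -
  let ?J = "foster_jump v"
  have "chord v mod 6 = (v mod 6 + ?J) mod 6"
    by (simp add: chord_def mod_mod_cancel mod_add_left_eq)
  then have "foster_jump (chord v) = - ?J"
    by (cases v rule: jump_cases) (simp_all add: foster_jump_def)
  then have "chord (chord v) = (v + ?J + - ?J) mod 90"
    by (simp add: chord_def[of "chord v"]) (simp add: chord_def mod_diff_left_eq)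
  then show ?thesis
    by (simp add: mod_90_vertex assms)
qed

lemma neighbors_distinct:
  shows "succ90 v \<noteq> pred90 v" "chord v \<noteq> succ90 v" "chord v \<noteq> pred90 v"
proof -
  show "succ90 v \<noteq> pred90 v"
    by (simp add: succ90_def pred90_def mod_eq_dvd_iff)
  show "chord v \<noteq> succ90 v" "chord v \<noteq> pred90 v"
    by (cases v rule: jump_cases;
        simp add: chord_def succ90_def pred90_def mod_eq_dvd_iff)+
qed

lemma no_loops:
  assumes "v \<in> foster_verts"
  shows "succ90 v \<noteq> v" "pred90 v \<noteq> v" "chord v \<noteq> v"
proof -
  have "(v + k) mod 90 = v \<longleftrightarrow> 90 dvd k" for k
    using mod_eq_dvd_iff[of "v + k" 90 v] mod_90_vertex[OF assms] by simp
  from this[of 1] this[of "-1"] this[of "foster_jump v"]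
  show "succ90 v \<noteq> v" "pred90 v \<noteq> v" "chord v \<noteq> v"
    by (simp_all add: succ90_def pred90_def chord_def) (cases v rule: jump_cases; simp)
qed

lemma foster_edges_eq:
  "foster_edges = (\<lambda>v. {v, succ90 v}) ` foster_verts \<union> (\<lambda>v. {v, chord v}) ` foster_verts"
  by (auto simp: foster_edges_def succ90_def chord_def)

lemma cycle_edge_iff:
  assumes "v \<in> foster_verts"
  shows "{v, w} \<in> (\<lambda>v. {v, succ90 v}) ` foster_verts \<longleftrightarrow> w = succ90 v \<or> w = pred90 v"
proof -
  have "{v, pred90 v} = {pred90 v, succ90 (pred90 v)}"
    using assms by auto
  then have "{v, pred90 v} \<in> (\<lambda>v. {v, succ90 v}) ` foster_verts"
    by (rule image_eqI) simp
  then show ?thesis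
    using assms by (auto simp: doubleton_eq_iff)
qed

lemma foster_edge_iff:
  assumes "v \<in> foster_verts"
  shows "{v, w} \<in> foster_edges \<longleftrightarrow> w \<in> {succ90 v, pred90 v, chord v}"
proof -
  have "{v, w} \<in> (\<lambda>v. {v, chord v}) ` foster_verts \<longleftrightarrow> w = chord v"
    using assms by (auto simp: doubleton_eq_iff)
  then show ?thesis
    by (auto simp: foster_edges_eq cycle_edge_iff[OF assms])
qed

lemma open_nbhd_foster:
  "v \<in> foster_verts \<Longrightarrow> open_nbhd foster_edges v = {succ90 v, pred90 v, chord v}"
  by (auto simp: open_nbhd_def foster_edge_iff)

lemma foster_edge_subset: "e \<in> foster_edges \<Longrightarrow> e \<subseteq> foster_verts"
  by (auto simp: foster_edges_eq)

lemma edge_at_vertex: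
  assumes "e \<in> foster_edges" "v \<in> e"
  obtains w where "e = {v, w}" "w \<in> {succ90 v, pred90 v, chord v}"
proof -
  obtain w where "e = {v, w}"
    using assms by (auto simp: foster_edges_eq)
  then show thesis
    using that assms foster_edge_iff[of v w] foster_edge_subset by blast
qed

lemma cubic_foster: "cubic_graph foster_verts foster_edges"
proof -
  have "card e = 2" if "e \<in> foster_edges" for e
    using that by (auto simp: foster_edges_eq no_loops[symmetric])
  moreover have "card (open_nbhd foster_edges v) = 3" if "v \<in> foster_verts" for v
    using neighbors_distinct[of v] by (simp add: open_nbhd_foster that)
  moreover have "finite foster_verts"
    by (simp add: foster_verts_def)
  ultimately show ?thesis
    using foster_edge_subset by (simp add: cubic_graph_def simple_graph_def)
qed

section \<open>Residues modulo 3\<close>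

lemma succ90_mod_3: "succ90 v mod 3 = (v + 1) mod 3"
  by (simp add: succ90_def mod_mod_cancel)

lemma pred90_mod_3: "pred90 v mod 3 = (v + 2) mod 3"
  unfolding pred90_def by (subst mod_mod_cancel; presburger)

text \<open>Each jump from a position \<open>r\<close> of the pattern is congruent to \<open>2 - 2 r\<close> modulo 3.\<close>
lemma chord_mod_3: "chord v mod 3 = (2 - v) mod 3"
  unfolding chord_def
  by (subst mod_mod_cancel, simp, cases v rule: jump_cases; simp; presburger)

lemma mod_3_cases:
  fixes v :: int
  obtains "v mod 3 = 0" | "v mod 3 = 1" | "v mod 3 = 2"
proof -
  have "v mod 3 = 0 \<or> v mod 3 = 1 \<or> v mod 3 = 2"
    by presburger
  then show thesis
    using that by metis
qed

lemma nat_mod_3_eq_iff: "nat (a mod 3) = nat (b mod 3) \<longleftrightarrow> a mod 3 = b mod 3" for a b :: int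
  by (simp add: eq_nat_nat_iff)

section \<open>The coloring by residues\<close>

text \<open>
  On a cycle edge the ends have consecutive residues \<open>r\<close> and \<open>r + 1\<close>, and
  \<open>- (r + (r + 1)) = r + 2\<close> modulo 3, so the negated sum of the ends is the residue that
  neither end has; it does not depend on an orientation of the edge.
\<close>
definition residue_coloring :: "int coloring" where
  "residue_coloring x = (case x of
      Inl v \<Rightarrow> nat (v mod 3)
    | Inr e \<Rightarrow> if e \<in> (\<lambda>v. {v, succ90 v}) ` foster_verts then nat ((- \<Sum> e) mod 3) else 3)"

lemma residue_coloring_vertex: "residue_coloring (Inl v) = nat (v mod 3)"
  by (simp add: residue_coloring_def)

lemma residue_coloring_at_vertex:
  assumes v: "v \<in> foster_verts"
  shows "residue_coloring (Inr {v, succ90 v}) = nat ((v + 2) mod 3)"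
    and "residue_coloring (Inr {v, pred90 v}) = nat ((v + 1) mod 3)"
    and "residue_coloring (Inr {v, chord v}) = 3"
proof -
  have sum_mod: "(- (v + w)) mod 3 = (- (v + w mod 3)) mod 3" for w
    by presburger
  have "(- (v + succ90 v)) mod 3 = (v + 2) mod 3"
    unfolding sum_mod[of "succ90 v"] succ90_mod_3 by presburger
  then show "residue_coloring (Inr {v, succ90 v}) = nat ((v + 2) mod 3)"
    using v no_loops[OF v] by (simp add: residue_coloring_def)
  have "(- (v + pred90 v)) mod 3 = (v + 1) mod 3"
    unfolding sum_mod[of "pred90 v"] pred90_mod_3 by presburger
  then show "residue_coloring (Inr {v, pred90 v}) = nat ((v + 1) mod 3)"
    using v no_loops[OF v] by (simp add: residue_coloring_def cycle_edge_iff)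
  show "residue_coloring (Inr {v, chord v}) = 3"
    using neighbors_distinct[of v] by (simp add: residue_coloring_def cycle_edge_iff[OF v])
qed

text \<open>
  At a vertex \<open>v\<close> the vertex, the edge to the predecessor and the edge to the successor have the
  colors \<open>v\<close>, \<open>v + 1\<close> and \<open>v + 2\<close> modulo 3, and the chord has color 3; these four colors differ.
\<close>
lemma residue_coloring_lacunar: "lacunar_stc foster_verts foster_edges residue_coloring"
proof -
  have small: "nat (k mod 3) \<in> colors" "nat (k mod 3) \<noteq> 3" for k :: int
    by (cases k rule: mod_3_cases; simp add: colors_def)+
  have "residue_coloring x \<in> colors" for x
    using small(1) by (auto simp: residue_coloring_def colors_def split: sum.split)
  moreover have "residue_coloring (Inr e) \<noteq> residue_coloring (Inr f)"
    if "e \<in> foster_edges" "f \<in> foster_edges" and ne: "e \<noteq> f" and "e \<inter> f \<noteq> {}" for e f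
  proof -
    from that obtain v where "v \<in> e" "v \<in> f" by blast
    obtain w where e: "e = {v, w}" "w \<in> {succ90 v, pred90 v, chord v}"
      using edge_at_vertex[OF \<open>e \<in> foster_edges\<close> \<open>v \<in> e\<close>] .
    obtain w' where f: "f = {v, w'}" "w' \<in> {succ90 v, pred90 v, chord v}"
      using edge_at_vertex[OF \<open>f \<in> foster_edges\<close> \<open>v \<in> f\<close>] .
    have v: "v \<in> foster_verts"
      using \<open>v \<in> e\<close> that foster_edge_subset by blast
    have "nat ((v + 1) mod 3) \<noteq> nat ((v + 2) mod 3)"
      unfolding nat_mod_3_eq_iff by presburger
    then show ?thesis
      using e f ne small(2)[of "v + 1"] small(2)[of "v + 2"]
      by (auto simp: residue_coloring_at_vertex[OF v])
  qed
  moreover have "residue_coloring (Inl v) \<noteq> residue_coloring (Inr e)"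
    if v: "v \<in> foster_verts" and "e \<in> foster_edges" "v \<in> e" for v e
  proof -
    obtain w where e: "e = {v, w}" "w \<in> {succ90 v, pred90 v, chord v}"
      using edge_at_vertex[OF \<open>e \<in> foster_edges\<close> \<open>v \<in> e\<close>] .
    have "nat (v mod 3) \<noteq> nat ((v + 1) mod 3)" "nat (v mod 3) \<noteq> nat ((v + 2) mod 3)"
      unfolding nat_mod_3_eq_iff by presburger+
    then show ?thesis
      using e small(2)[of v]
      by (auto simp: residue_coloring_at_vertex[OF v] residue_coloring_vertex)
  qed
  moreover have "\<forall>v \<in> foster_verts. residue_coloring (Inl v) \<noteq> 3"
    using small(2) by (simp add: residue_coloring_vertex)
  moreover have "3 \<in> colors"
    by (simp add: colors_def)
  ultimately show ?thesis
    unfolding lacunar_stc_def semi_total_coloring_def using cubic_foster by blast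
qed

section \<open>The total perfect code\<close>

lemma residue_one_total_perfect_code:
  "total_perfect_code foster_verts foster_edges {v \<in> foster_verts. v mod 3 = 1}"
proof -
  have "card (open_nbhd foster_edges v \<inter> {v \<in> foster_verts. v mod 3 = 1}) = 1"
    if v: "v \<in> foster_verts" for v
  proof -
    have res: "succ90 v mod 3 = 1 \<longleftrightarrow> v mod 3 = 0" "pred90 v mod 3 = 1 \<longleftrightarrow> v mod 3 = 2"
      "chord v mod 3 = 1 \<longleftrightarrow> v mod 3 = 1"
      unfolding succ90_mod_3 pred90_mod_3 chord_mod_3 by presburger+
    have "open_nbhd foster_edges v \<inter> {v \<in> foster_verts. v mod 3 = 1}
        = {if v mod 3 = 0 then succ90 v else if v mod 3 = 1 then chord v else pred90 v}"
      unfolding open_nbhd_foster[OF v] by (cases v rule: mod_3_cases) (auto simp: res)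
    then show ?thesis
      by simp
  qed
  then show ?thesis
    by (auto simp: total_perfect_code_def)
qed

lemma Union_beta_edges:
  "\<Union> (beta_edges foster_edges residue_coloring) = {v \<in> foster_verts. v mod 3 = 1}"
proof (intro equalityI subsetI)
  fix v assume "v \<in> \<Union> (beta_edges foster_edges residue_coloring)"
  then obtain e where e: "e \<in> foster_edges" "v \<in> e"
    and beta: "\<And>a b. a \<in> e \<Longrightarrow> b \<in> e \<Longrightarrow> nat (a mod 3) = nat (b mod 3)"
    by (auto simp: beta_edges_def residue_coloring_vertex)
  obtain w where w: "e = {v, w}" "w \<in> {succ90 v, pred90 v, chord v}"
    using edge_at_vertex[OF e] .
  have "w mod 3 = v mod 3"
    using beta[of w v] w(1) by simp
  moreover have "succ90 v mod 3 \<noteq> v mod 3" "pred90 v mod 3 \<noteq> v mod 3"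
    unfolding succ90_mod_3 pred90_mod_3 by presburger+
  ultimately have "(2 - v) mod 3 = v mod 3"
    using w(2) by (auto simp: chord_mod_3)
  then have "v mod 3 = 1"
    by presburger
  then show "v \<in> {v \<in> foster_verts. v mod 3 = 1}"
    using e foster_edge_subset by blast
next
  fix v assume "v \<in> {v \<in> foster_verts. v mod 3 = 1}"
  then have v: "v \<in> foster_verts" "v mod 3 = 1"
    by auto
  then have "chord v mod 3 = 1"
    unfolding chord_mod_3 by presburger
  then have "{v, chord v} \<in> beta_edges foster_edges residue_coloring"
    using v by (auto simp: beta_edges_def foster_edge_iff residue_coloring_vertex)
  then show "v \<in> \<Union> (beta_edges foster_edges residue_coloring)"
    by blast
qed

lemma vertex_part_residue_class:
  "vertex_part (color_class foster_verts foster_edges residue_coloring c)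
     = {v \<in> foster_verts. nat (v mod 3) = c}"
  by (auto simp: vertex_part_def color_class_def residue_coloring_vertex)

theorem theorem44:
  shows "\<exists>\<mu>. one_total_two_perfect foster_verts foster_edges \<mu>"
proof
  have class_one: "{v \<in> foster_verts. nat (v mod 3) = 1} = {v \<in> foster_verts. v mod 3 = 1}"
    by auto
  show "one_total_two_perfect foster_verts foster_edges residue_coloring"
    unfolding one_total_two_perfect_def vertex_part_residue_class Union_beta_edges
  proof (intro conjI ex1I[of _ 1])
    show "lacunar_stc foster_verts foster_edges residue_coloring"
      by (fact residue_coloring_lacunar)
    show "1 \<in> colors"
      by (simp add: colors_def)
    show "total_perfect_code foster_verts foster_edges {v \<in> foster_verts. nat (v mod 3) = 1}"
      unfolding class_one by (fact residue_one_total_perfect_code)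
    show "{v \<in> foster_verts. nat (v mod 3) = 1} = {v \<in> foster_verts. v mod 3 = 1}"
      by (fact class_one)
  next
    fix c
    assume "c \<in> colors \<and>
      total_perfect_code foster_verts foster_edges {v \<in> foster_verts. nat (v mod 3) = c} \<and>
      {v \<in> foster_verts. nat (v mod 3) = c} = {v \<in> foster_verts. v mod 3 = 1}"
    moreover have "(1 :: int) \<in> {v \<in> foster_verts. v mod 3 = 1}"
      by (simp add: foster_verts_def)
    ultimately have "(1 :: int) \<in> {v \<in> foster_verts. nat (v mod 3) = c}"
      by simp
    then show "c = 1"
      by simp
  qed
qed

end
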